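(* For every real $\lambda \ge 0.7983$, every real $x\ge 2$, and every $2$-primitive set $A$, \[ \sum_{\substack{n \in A\\ n\le x}} \frac{1}{n^\lambda} \;\le\; \sum_{\substack{p \in \mathcal{P}(A)\\ p\le x}} \frac{1}{p^\lambda}. \]
   Context: A set $A$ of integers greater than $1$ with $|A|\ge 3$ is called $2$-primitive if no element of $A$ divides the product of $2$ distinct other elements of $A$. $\mathcal{P}(A)$ denotes the set of primes dividing some member of $A$; $p$ runs over primes. *)

theory Defs
  imports Complex_Main "HOL-Computational_Algebra.Primes"
begin

text \<open>The set may be infinite, and \<^const>\<open>card\<close> is 0 on infinite sets, so the
  cardinality condition is only imposed on finite sets.\<close>

definition two_primitive :: "nat set \<Rightarrow> bool" where
  "two_primitive A \<longleftrightarrow>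
     (\<forall>a\<in>A. 1 < a) \<and>
     (finite A \<longrightarrow> 3 \<le> card A) \<and>
     (\<forall>a\<in>A. \<forall>b\<in>A. \<forall>c\<in>A. a \<noteq> b \<and> a \<noteq> c \<and> b \<noteq> c \<longrightarrow> \<not> a dvd b * c)"

definition primes_dividing :: "nat set \<Rightarrow> nat set" where
  "primes_dividing A = {p. prime p \<and> (\<exists>a\<in>A. p dvd a)}"

end

theory Submission imports Defs begin

text \<open>
  A divisor of \<open>n \<in> A\<close> is private if it divides no other element of \<open>A\<close>. In a 2-primitive set,
  whenever \<open>n = u v\<close> with \<open>u, v\<close> coprime, one of \<open>u, v\<close> is private. Let \<open>d\<close> be the least private
  divisor of \<open>n\<close> that is coprime to \<open>c = n / d\<close>. If \<open>d = u v\<close> is a proper coprime factorization,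
  then \<open>v < d\<close> is not private, so \<open>u c\<close> is private, and \<open>u v \<le> u c\<close> by minimality: every such \<open>v\<close>
  is less than \<open>c\<close>. If \<open>d\<close> is not a power of a prime, choose \<open>p\<close> such that \<open>d = p\<^sup>f r\<close> with
  \<open>p\<^sup>f < r\<close>; then \<open>n = p\<^sup>f r c\<close> with \<open>p\<^sup>f < r < c\<close>. If \<open>d\<close> is a power of \<open>p\<close>, it is the full power
  of \<open>p\<close> in \<open>n\<close>. In both cases charge \<open>n\<close> to \<open>p\<close>.

  Charges of the first kind to \<open>p\<close> are determined by \<open>f\<close> and \<open>r\<close>, and contribute
  \<open>(p / n) powr \<lambda> = (p\<^sup>f\<^sup>-\<^sup>1 r c) powr -\<lambda>\<close> relative to \<open>p powr -\<lambda>\<close>. Since \<open>c > r\<close>, comparison with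
  the integral of \<open>t powr -2\<lambda>\<close> shows that their total is less than 1. There is at most one charge of
  the second kind. If there are also charges of the first kind, it comes from some \<open>n\<close> so large
  that its contribution fits into the remaining room.
\<close>

section \<open>Private divisors\<close>

definition private_divisor :: "nat set \<Rightarrow> nat \<Rightarrow> nat \<Rightarrow> bool" where
  "private_divisor A n d \<longleftrightarrow> d dvd n \<and> (\<forall>b\<in>A. d dvd b \<longrightarrow> b = n)"

definition primary_private :: "nat set \<Rightarrow> nat \<Rightarrow> nat \<Rightarrow> bool" where
  "primary_private A p n \<longleftrightarrow> private_divisor A n (p ^ multiplicity p n)"

definition composite_private :: "nat set \<Rightarrow> nat \<Rightarrow> nat \<Rightarrow> nat \<Rightarrow> bool" where
  "composite_private A p n r \<longleftrightarrow> private_divisor A n (p ^ multiplicity p n * r) \<and>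
     p ^ multiplicity p n < r \<and> (\<exists>c>r. n = p ^ multiplicity p n * r * c)"

lemma two_primitive_dvd_imp_eq:
  assumes A: "two_primitive A" and ab: "a \<in> A" "b \<in> A" "a dvd b"
  shows "a = b"
proof (rule ccontr)
  assume "a \<noteq> b"
  have "\<not> A \<subseteq> {a, b}"
  proof
    assume sub: "A \<subseteq> {a, b}"
    then have "finite A" by (rule finite_subset) simp
    moreover have "card A \<le> 2" using card_mono[OF _ sub] \<open>a \<noteq> b\<close> by simp
    ultimately show False using A by (auto simp: two_primitive_def)
  qed
  then obtain c where "c \<in> A" "c \<noteq> a" "c \<noteq> b" by blast
  moreover have "a dvd b * c" using \<open>a dvd b\<close> by simp
  ultimately show False using A ab \<open>a \<noteq> b\<close> unfolding two_primitive_def by metis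
qed

lemma private_divisor_coprime_factor:
  assumes A: "two_primitive A" and n: "u * v \<in> A" and coprime: "coprime u v"
  shows "private_divisor A (u * v) u \<or> private_divisor A (u * v) v"
proof (rule ccontr)
  assume "\<not> ?thesis"
  then obtain b c where b: "b \<in> A" "b \<noteq> u * v" "u dvd b" and c: "c \<in> A" "c \<noteq> u * v" "v dvd c"
    by (auto simp: private_divisor_def)
  have "u * v dvd b * c" using b c by (simp add: mult_dvd_mono)
  then have "b = c" using A n b(1,2) c(1,2) unfolding two_primitive_def by metis
  then have "u * v dvd b" using b c coprime by (simp add: divides_mult)
  then show False using two_primitive_dvd_imp_eq[OF A n] b by blast
qed

lemma prime_power_dvd_div_prime_power:
  fixes d :: nat
  assumes "prime p" "prime q" "p \<noteq> q"
  shows "q ^ multiplicity q d dvd d div p ^ multiplicity p d"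
proof -
  have "coprime (q ^ multiplicity q d) (p ^ multiplicity p d)"
    using assms by (simp add: primes_coprime)
  moreover have "q ^ multiplicity q d dvd p ^ multiplicity p d * (d div p ^ multiplicity p d)"
    by (simp add: multiplicity_dvd)
  ultimately show ?thesis by (simp add: coprime_dvd_mult_right_iff)
qed

lemma exists_prime_power_less_cofactor:
  fixes d :: nat
  assumes d: "d > 1" and no_prime_power: "\<And>p. prime p \<Longrightarrow> p dvd d \<Longrightarrow> d \<noteq> p ^ multiplicity p d"
  shows "\<exists>p. prime p \<and> p dvd d \<and> p ^ multiplicity p d < d div p ^ multiplicity p d"
proof -
  obtain p where p: "prime p" "p dvd d" using d prime_factor_nat by (metis less_irrefl)
  let ?r = "d div p ^ multiplicity p d"
  have d_eq: "d = p ^ multiplicity p d * ?r" by (simp add: multiplicity_dvd)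
  then have "?r \<noteq> 1" using no_prime_power[OF p] by (metis mult.right_neutral)
  then obtain q where q: "prime q" "q dvd ?r" using prime_factor_nat by blast
  then have qd: "q dvd d" using d_eq by (metis dvd_mult)
  have "\<not> p dvd ?r" using p d by (intro multiplicity_decompose) (auto simp: prime_nat_iff)
  then have "p \<noteq> q" using q by blast
  have pos: "d div s ^ multiplicity s d > 0" for s
    using d by (metis dvd_div_eq_0_iff multiplicity_dvd not_gr0 not_less0)
  have le: "q ^ multiplicity q d \<le> ?r" "p ^ multiplicity p d \<le> d div q ^ multiplicity q d"
    using prime_power_dvd_div_prime_power[of p q d] prime_power_dvd_div_prime_power[of q p d]
      p(1) q(1) \<open>p \<noteq> q\<close> pos by (simp_all add: dvd_imp_le)
  have "multiplicity q d > 0" using q qd d by (simp add: prime_multiplicity_gt_zero_iff)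
  then have "p ^ multiplicity p d \<noteq> q ^ multiplicity q d"
    using p q \<open>p \<noteq> q\<close> by (metis dvd_power prime_dvd_power primes_dvd_imp_eq)
  then show ?thesis using le p q qd by (meson le_less_trans linorder_neqE_nat order_less_le_trans)
qed

lemma multiplicity_mult_coprime:
  fixes p c d :: nat
  assumes "prime p" "p dvd d" "coprime d c"
  shows "multiplicity p (d * c) = multiplicity p d"
proof -
  have "\<not> p dvd c" using assms by (metis coprime_common_divisor not_prime_unit)
  then have "multiplicity p (c * d) = multiplicity p d"
    using assms(1) by (intro multiplicity_prime_elem_times_other prime_imp_prime_elem)
  then show ?thesis by (simp only: mult.commute)
qed

lemma exists_balanced_private_divisor:
  assumes A: "two_primitive A" and n: "n \<in> A"
  shows "\<exists>c d. n = d * c \<and> coprime d c \<and> private_divisor A n d \<and>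
    (\<forall>u v. d = u * v \<longrightarrow> coprime u v \<longrightarrow> 1 < u \<longrightarrow> 1 < v \<longrightarrow> v < c)"
proof -
  define D where "D = (\<lambda>d. private_divisor A n d \<and> (\<exists>c. n = d * c \<and> coprime d c))"
  define d where "d = (LEAST d. D d)"
  have "D n" using two_primitive_dvd_imp_eq[OF A n] by (auto simp: D_def private_divisor_def)
  then have "D d" unfolding d_def by (rule LeastI)
  then obtain c where c: "private_divisor A n d" "n = d * c" "coprime d c" by (auto simp: D_def)
  have least: "d \<le> e" if "D e" for e unfolding d_def using that by (rule Least_le)
  have "d > 0" using A n c(2) by (cases d) (auto simp: two_primitive_def)
  have "v < c" if uv: "d = u * v" "coprime u v" "1 < u" "1 < v" for u v
  proof -
    have coprime_v: "coprime v (u * c)" "coprime v c" using c(3) uv by (auto simp: coprime_commute)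
    have n_eq: "n = v * (u * c)" using c(2) uv(1) by simp
    have "v < d" using uv \<open>d > 0\<close> by simp
    then have "\<not> private_divisor A n v" using least[of v] coprime_v(1) n_eq unfolding D_def by force
    then have "private_divisor A n (u * c)"
      using private_divisor_coprime_factor[OF A, of v "u * c"] n n_eq coprime_v(1) by simp
    then have "d \<le> u * c"
      using coprime_v(1) n_eq by (intro least) (auto simp: D_def coprime_commute mult.commute)
    then have "v \<le> c" using uv by simp
    then show ?thesis using coprime_v(2) \<open>1 < v\<close> by (cases "v = c") auto
  qed
  then show ?thesis using c by blast
qed

lemma exists_primary_or_composite_private:
  assumes A: "two_primitive A" and n: "n \<in> A"
  shows "\<exists>p. prime p \<and> p dvd n \<and> (primary_private A p n \<or> (\<exists>r. composite_private A p n r))"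
proof (rule ccontr)
  assume none: "\<not> ?thesis"
  have n1: "n > 1" using A n by (simp add: two_primitive_def)
  obtain c d where c: "n = d * c" "coprime d c" "private_divisor A n d"
    and balanced: "\<And>u v. d = u * v \<Longrightarrow> coprime u v \<Longrightarrow> 1 < u \<Longrightarrow> 1 < v \<Longrightarrow> v < c"
    using exists_balanced_private_divisor[OF A n] by blast
  note multiplicity_eq = multiplicity_mult_coprime[OF _ _ c(2), folded c(1)]
  have "d \<noteq> 1"
  proof
    assume "d = 1"
    then have "private_divisor A n e" if "e dvd n" for e
      using c(3) that by (auto simp: private_divisor_def)
    moreover obtain p where "prime p" "p dvd n" using n1 prime_factor_nat by (metis less_irrefl)
    ultimately show False using none by (auto simp: primary_private_def multiplicity_dvd)
  qed
  moreover have "d > 0" using c(1) n1 by (cases d) auto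
  moreover have "d \<noteq> p ^ multiplicity p d" if "prime p" "p dvd d" for p
    using none c(1,3) that multiplicity_eq[OF that] unfolding primary_private_def by (metis dvd_mult2)
  ultimately obtain p where p: "prime p" "p dvd d" "p ^ multiplicity p d < d div p ^ multiplicity p d"
    using exists_prime_power_less_cofactor[of d] by auto
  define r where "r = d div p ^ multiplicity p d"
  have d: "d = p ^ multiplicity p d * r" by (simp add: r_def multiplicity_dvd)
  have "\<not> p dvd r" unfolding r_def
    using p \<open>d > 0\<close> by (intro multiplicity_decompose) (auto simp: prime_nat_iff)
  then have "coprime (p ^ multiplicity p d) r" using p by (simp add: prime_imp_coprime)
  moreover have "1 < p ^ multiplicity p d"
    using p(1,2) \<open>d > 0\<close> prime_gt_1_nat[of p]
    by (intro one_less_power) (simp_all add: prime_multiplicity_gt_zero_iff)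
  ultimately have "r < c" using balanced[OF d] p(3) by (simp add: r_def)
  then have "composite_private A p n r"
    using c(1,3) d p(3) unfolding composite_private_def multiplicity_eq[OF p(1,2)]
    by (metis r_def)
  moreover have "p dvd n" using p c(1) by simp
  ultimately show False using none p(1) by blast
qed

section \<open>Sums of powers over integers coprime to a prime\<close>

lemma powr_minus_midpoint_le:
  fixes m t a :: real
  assumes "a \<ge> 0" "0 \<le> t" "t < m"
  shows "2 * m powr - a \<le> (m - t) powr - a + (m + t) powr - a"
proof -
  define x where "x = (m - t) powr - (a / 2)"
  define y where "y = (m + t) powr - (a / 2)"
  have "m powr - a = (m\<^sup>2) powr - (a / 2)"
    using assms by (simp add: powr_powr flip: powr_numeral)
  also have "\<dots> \<le> ((m - t) * (m + t)) powr - (a / 2)"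
    using assms by (intro powr_mono2' mult_pos_pos) (auto simp: power2_eq_square algebra_simps)
  also have "\<dots> = x * y" by (simp add: x_def y_def powr_mult)
  finally have "2 * m powr - a \<le> 2 * x * y" by simp
  also have "\<dots> \<le> x\<^sup>2 + y\<^sup>2" by (rule sum_squares_bound)
  also have "x\<^sup>2 + y\<^sup>2 = (m - t) powr - a + (m + t) powr - a"
    by (simp add: x_def y_def power2_eq_square flip: powr_add)
  finally show ?thesis .
qed

lemma powr_midpoint_rule_le:
  fixes m h a :: real
  assumes a: "a > 1" and h: "0 \<le> h" "h < 2 * m"
  shows "h * m powr - a \<le> ((m - h / 2) powr (1 - a) - (m + h / 2) powr (1 - a)) / (a - 1)"
proof -
  define g where "g t = (m - t) powr (1 - a) - (m + t) powr (1 - a) - (a - 1) * (2 * t * m powr - a)" for t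
  have "g 0 \<le> g (h / 2)"
  proof (rule DERIV_nonneg_imp_nondecreasing[where f = g])
    fix t assume t: "0 \<le> t" "t \<le> h / 2"
    have "(g has_real_derivative (a - 1) * ((m - t) powr - a + (m + t) powr - a - 2 * m powr - a)) (at t)"
      unfolding g_def using h t by (auto intro!: derivative_eq_intros simp: algebra_simps)
    moreover have "0 \<le> (a - 1) * ((m - t) powr - a + (m + t) powr - a - 2 * m powr - a)"
      using powr_minus_midpoint_le[of a t m] a h t by simp
    ultimately show "\<exists>D. (g has_real_derivative D) (at t) \<and> 0 \<le> D" by blast
  qed (use h in auto)
  then show ?thesis using a by (simp add: g_def pos_le_divide_eq mult.commute)
qed

lemma sum_powr_arith_progression_le:
  fixes K :: "nat set" and N :: nat and h b a :: real
  assumes K: "finite K" "\<And>k. k \<in> K \<Longrightarrow> k > N" and h: "h > 0" and a: "a > 1" and pos: "h * N + b > 0"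
  shows "(\<Sum>k\<in>K. (h * (k - 1 / 2) + b) powr - a) \<le> (h * N + b) powr (1 - a) / (h * (a - 1))"
proof -
  define G where "G k = (h * real k + b) powr (1 - a) / (h * (a - 1))" for k :: nat
  define M where "M = Max (insert N K)"
  have M: "N \<le> M" "K \<subseteq> {N<..M}" using K by (auto simp: M_def)
  have step: "(h * (Suc k - 1 / 2) + b) powr - a \<le> G k - G (Suc k)" if "k \<ge> N" for k
  proof -
    have "h * N \<le> h * k" using h that by simp
    then have "h < 2 * (h * (Suc k - 1 / 2) + b)" using pos by (simp add: algebra_simps)
    then have "h * (h * (Suc k - 1 / 2) + b) powr - a
        \<le> ((h * k + b) powr (1 - a) - (h * Suc k + b) powr (1 - a)) / (a - 1)"
      using powr_midpoint_rule_le[OF a, of h "h * (Suc k - 1 / 2) + b"] h by (simp add: algebra_simps)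
    also have "\<dots> = h * (G k - G (Suc k))"
      using h by (simp add: G_def flip: diff_divide_distrib)
    finally show ?thesis using h by simp
  qed
  have "(\<Sum>k\<in>K. (h * (k - 1 / 2) + b) powr - a) \<le> (\<Sum>k\<in>{N<..M}. (h * (k - 1 / 2) + b) powr - a)"
    using M by (intro sum_mono2) auto
  also have "\<dots> = (\<Sum>k=N..<M. (h * (Suc k - 1 / 2) + b) powr - a)"
    by (simp only: atLeastSucAtMost_greaterThanAtMost[symmetric] sum.shift_bounds_Suc_ivl
        atLeastLessThanSuc_atLeastAtMost[symmetric])
  also have "\<dots> \<le> (\<Sum>k=N..<M. G k - G (Suc k))" by (intro sum_mono step) simp
  also have "\<dots> = G N - G M" using sum_Suc_diff'[of N M "\<lambda>k. - G k"] M by (simp add: algebra_simps)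
  also have "\<dots> \<le> G N" using h a by (simp add: G_def)
  finally show ?thesis by (simp add: G_def)
qed

text \<open>For a prime \<open>p\<close>, this is the number of integers in \<open>{1..r}\<close> that are coprime to \<open>p\<close>.\<close>

definition coprime_count :: "nat \<Rightarrow> nat \<Rightarrow> nat" where
  "coprime_count p r = r - r div p"

lemma coprime_count_Suc:
  "coprime_count p (Suc r) = (if p dvd Suc r then coprime_count p r else Suc (coprime_count p r))"
  by (auto simp: coprime_count_def div_Suc dvd_eq_mod_eq_0 Suc_diff_le)

lemma coprime_count_less:
  assumes "r < s" "\<not> p dvd s"
  shows "coprime_count p r < coprime_count p s"
proof -
  obtain t where t: "s = Suc t" "r \<le> t" using assms(1) by (cases s) auto
  have "coprime_count p r \<le> coprime_count p t"
    using t(2) by (rule lift_Suc_mono_le[rotated]) (simp add: coprime_count_Suc)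
  then show ?thesis using assms(2) t(1) by (simp add: coprime_count_Suc)
qed

lemma inj_on_coprime_count: "inj_on (coprime_count p) {r. \<not> p dvd r}"
  by (rule linorder_inj_onI') (auto dest: coprime_count_less)

lemma coprime_count_power_Suc: "coprime_count p (p ^ Suc e) = p ^ Suc e - p ^ e"
  by (cases "p = 0") (simp_all add: coprime_count_def)

text \<open>The midpoints of consecutive intervals of length \<open>p / (p - 1)\<close>, one for each \<open>r\<close> coprime to \<open>p\<close>.
  If \<open>c > r\<close> is coprime to \<open>p\<close>, then \<open>c \<ge> r + 2\<close> in case \<open>p\<close> divides \<open>r + 1\<close>; this makes the shift
  by \<open>4 / (5 (p - 1))\<close> possible, which is needed for \<open>p = 2\<close> only.\<close>

definition coprime_midpoint :: "nat \<Rightarrow> nat \<Rightarrow> real" where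
  "coprime_midpoint p r = p / (real p - 1) * (coprime_count p r - 1 / 2) + 4 / (5 * (real p - 1))"

lemma coprime_midpoint_eq:
  assumes "p > 1"
  shows "coprime_midpoint p r = r + (real (r mod p) - p / 2 + 4 / 5) / (real p - 1)"
proof -
  have decomposition: "real r = real p * real (r div p) + real (r mod p)"
    by (metis mult_div_mod_eq of_nat_add of_nat_mult)
  have count: "real (coprime_count p r) = real r - real (r div p)" by (simp add: coprime_count_def)
  have "p * (coprime_count p r - 1 / 2) + 4 / 5 = (real p - 1) * r + (real (r mod p) - p / 2 + 4 / 5)"
    using decomposition unfolding count by (simp add: algebra_simps)
  then have "(p * (coprime_count p r - 1 / 2) + 4 / 5) / (real p - 1)
      = r + (real (r mod p) - p / 2 + 4 / 5) / (real p - 1)"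
    using assms by (simp add: add_divide_distrib)
  then show ?thesis by (simp add: coprime_midpoint_def add_divide_distrib)
qed

lemma coprime_midpoint_square_le:
  fixes p r c :: nat
  assumes p: "p > 1" and r: "p < r" "\<not> p dvd r" and c: "r < c" "\<not> p dvd c"
  shows "(coprime_midpoint p r)\<^sup>2 \<le> real r * c"
proof -
  define j where "j = r mod p"
  define e where "e = (real j - p / 2 + 4 / 5) / (real p - 1)"
  have midpoint: "coprime_midpoint p r = r + e"
    using coprime_midpoint_eq[OF p] by (simp add: e_def j_def)
  have j: "1 \<le> j" "j < p"
    using p r by (auto simp: j_def Suc_le_eq mod_greater_zero_iff_not_dvd)
  have "e \<ge> - 1 / 2" using p j by (simp add: e_def field_simps)
  then have nonneg: "0 \<le> r + e" using r p by linarith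
  show ?thesis
  proof (cases "c = r + 1")
    case False
    then have "r + 2 \<le> c" using c by simp
    have "e \<le> 4 / 5" using p j by (simp add: e_def field_simps)
    then have "(r + e)\<^sup>2 \<le> (r + 4 / 5)\<^sup>2" using nonneg by (intro power_mono) auto
    also have "\<dots> \<le> real r * (r + 2)" using p r by (simp add: power2_eq_square algebra_simps)
    also have "\<dots> \<le> real r * c" using \<open>r + 2 \<le> c\<close> by (intro mult_left_mono) auto
    finally show ?thesis by (simp only: midpoint)
  next
    case True
    have "Suc j \<noteq> p"
    proof
      assume "Suc j = p"
      then have "p dvd c" using True by (simp add: j_def mod_Suc dvd_eq_mod_eq_0)
      then show False using c(2) by simp
    qed
    then have "j + 2 \<le> p" using j by simp
    then have j_le: "real j + 2 \<le> p" by linarith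
    then have "e \<le> 1 / 2" using p by (simp add: e_def field_simps)
    have "(1 - 2 * e) * (real p - 1) = 2 * real p - 2 * j - 13 / 5"
      using p by (simp add: e_def left_diff_distrib)
    then have "7 / 5 \<le> (1 - 2 * e) * (real p - 1)" using j_le by simp
    also have "\<dots> \<le> (1 - 2 * e) * r" using \<open>e \<le> 1 / 2\<close> r by (intro mult_left_mono) auto
    finally have "7 / 5 \<le> (1 - 2 * e) * r" .
    moreover have "e\<^sup>2 \<le> 1" using \<open>- 1 / 2 \<le> e\<close> \<open>e \<le> 1 / 2\<close> by (simp add: abs_square_le_1)
    ultimately have "(r + e)\<^sup>2 \<le> real r * (r + 1)" by (simp add: power2_eq_square algebra_simps)
    then show ?thesis using True by (simp only: midpoint)
  qed
qed

lemma coprime_midpoint_pos: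
  assumes "p > 1" "r > 0" "\<not> p dvd r"
  shows "coprime_midpoint p r > 0"
proof -
  have "coprime_count p 0 < coprime_count p r" using assms by (intro coprime_count_less) auto
  then show ?thesis
    unfolding coprime_midpoint_def using assms(1) by (intro add_pos_pos mult_pos_pos) auto
qed

text \<open>\<open>1 - 1 / p\<close> times the integral of \<open>t powr - a\<close> over \<open>t > x\<close>\<close>

definition coprime_tail :: "real \<Rightarrow> real \<Rightarrow> real \<Rightarrow> real" where
  "coprime_tail a p x = (1 - 1 / p) * x powr (1 - a) / (a - 1)"

lemma sum_coprime_midpoint_powr_le:
  fixes a :: real
  assumes p: "p > 1" and a: "a > 1" and R: "finite R" "\<And>r. r \<in> R \<Longrightarrow> p ^ Suc e < r \<and> \<not> p dvd r"
  shows "(\<Sum>r\<in>R. coprime_midpoint p r powr - a) \<le> coprime_tail a p (real p ^ Suc e + 4 / (5 * (real p - 1)))"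
proof -
  define h where "h = p / (real p - 1)"
  define b where "b = 4 / (5 * (real p - 1))"
  define N where "N = coprime_count p (p ^ Suc e)"
  have "p ^ e \<le> p ^ Suc e" using p by (intro power_increasing) auto
  then have "real N = real p ^ e * (real p - 1)"
    unfolding N_def coprime_count_power_Suc by (simp add: algebra_simps)
  then have hN: "h * N + b = real p ^ Suc e + 4 / (5 * (real p - 1))"
    using p by (simp add: h_def b_def)
  have "inj_on (coprime_count p) R"
    using R(2) by (intro inj_on_subset[OF inj_on_coprime_count]) auto
  then have "(\<Sum>r\<in>R. coprime_midpoint p r powr - a)
      = (\<Sum>k\<in>coprime_count p ` R. (h * (k - 1 / 2) + b) powr - a)"
    by (simp add: sum.reindex coprime_midpoint_def h_def b_def)
  also have "\<dots> \<le> (h * N + b) powr (1 - a) / (h * (a - 1))"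
  proof (rule sum_powr_arith_progression_le)
    show "k > N" if "k \<in> coprime_count p ` R" for k
      using that R(2) coprime_count_less by (auto simp: N_def)
    show "h * N + b > 0" unfolding hN using p by (intro add_pos_pos) auto
  qed (use R p a in \<open>auto simp: h_def\<close>)
  also have "\<dots> = coprime_tail a p (real p ^ Suc e + 4 / (5 * (real p - 1)))"
    unfolding hN coprime_tail_def using p by (simp add: h_def field_simps)
  finally show ?thesis .
qed

section \<open>Sums over composite private divisors\<close>

lemma composite_privateE:
  assumes p: "prime p" and e: "multiplicity p n = Suc e" and r: "composite_private A p n r"
  obtains c where "n = p ^ Suc e * r * c" "p ^ Suc e < r" "r < c" "\<not> p dvd r" "\<not> p dvd c"
proof -
  obtain c where c: "n = p ^ Suc e * r * c" "p ^ Suc e < r" "r < c"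
    using r e by (auto simp: composite_private_def)
  have "n > 0" using c prime_gt_0_nat[OF p] by simp
  have "\<not> p ^ Suc (Suc e) dvd n"
    using e p \<open>n > 0\<close> by (subst power_dvd_iff_le_multiplicity) (auto simp: prime_nat_iff)
  then have "\<not> p * p ^ Suc e dvd r * c * p ^ Suc e" using c(1) by (simp add: ac_simps)
  then have "\<not> p dvd r * c" using mult_dvd_mono[OF _ dvd_refl] by blast
  then show ?thesis using c that by (metis dvd_mult dvd_mult2)
qed

lemma composite_private_inj:
  assumes "m \<in> A" "multiplicity p n = multiplicity p m" "composite_private A p n r" "composite_private A p m r"
  shows "n = m"
proof -
  have "p ^ multiplicity p n * r dvd m" using assms(2,4) by (simp add: composite_private_def private_divisor_def)
  then show ?thesis using assms(1,3) by (auto simp: composite_private_def private_divisor_def)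
qed

lemma composite_private_powr_le:
  fixes lam :: real
  assumes p: "prime p" and e: "multiplicity p n = Suc e" and r: "composite_private A p n r"
    and lam: "lam \<ge> 0"
  shows "(p / n) powr lam \<le> (p powr - lam) ^ e * coprime_midpoint p r powr - (2 * lam)"
proof -
  obtain c where c: "n = p ^ Suc e * r * c" "p ^ Suc e < r" "r < c" "\<not> p dvd r" "\<not> p dvd c"
    using composite_privateE[OF p e r] .
  have p1: "p > 1" using p prime_gt_1_nat by blast
  have "p \<le> p ^ Suc e" using p1 by simp
  then have "p < r" using c(2) by (rule le_less_trans)
  then have pos: "coprime_midpoint p r > 0" using p1 c(4) by (intro coprime_midpoint_pos) auto
  then have "(r * c) powr - lam \<le> ((coprime_midpoint p r)\<^sup>2) powr - lam"
    using coprime_midpoint_square_le[OF p1 \<open>p < r\<close> c(4,3,5)] lam by (intro powr_mono2') auto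
  also have "\<dots> = coprime_midpoint p r powr - (2 * lam)"
    using pos by (simp add: powr_powr flip: powr_numeral)
  finally have "(real p ^ e) powr - lam * (r * c) powr - lam
      \<le> (real p ^ e) powr - lam * coprime_midpoint p r powr - (2 * lam)"
    by (intro mult_left_mono) auto
  moreover have "(p / n) powr lam = (real p ^ e) powr - lam * (r * c) powr - lam"
    using p1 by (simp add: c(1) powr_divide powr_minus_divide powr_mult)
  moreover have "(real p ^ e) powr - lam = (p powr - lam) ^ e"
    using p1 by (simp add: powr_powr mult.commute flip: powr_realpow)
  ultimately show ?thesis by simp
qed

lemma composite_private_sum_level_le:
  fixes lam :: real
  assumes p: "prime p" and lam: "lam > 1 / 2" and F: "finite F" "F \<subseteq> A"
    and composite: "\<And>n. n \<in> F \<Longrightarrow> multiplicity p n = Suc e \<and> (\<exists>r. composite_private A p n r)"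
  shows "(\<Sum>n\<in>F. (p / n) powr lam)
    \<le> (p powr - lam) ^ e * coprime_tail (2 * lam) p (real p ^ Suc e + 4 / (5 * (real p - 1)))"
proof -
  obtain \<rho> where \<rho>: "\<And>n. n \<in> F \<Longrightarrow> composite_private A p n (\<rho> n)" using composite by metis
  have inj: "inj_on \<rho> F"
  proof (rule inj_onI)
    fix n m assume "n \<in> F" "m \<in> F" "\<rho> n = \<rho> m"
    then show "n = m"
      using composite_private_inj[of m A p n "\<rho> n"] composite[of n] composite[of m] \<rho>[of n] \<rho>[of m] F(2)
      by auto
  qed
  have \<rho>_range: "p ^ Suc e < r \<and> \<not> p dvd r" if r: "r \<in> \<rho> ` F" for r
  proof -
    obtain n where "n \<in> F" "r = \<rho> n" using r by blast
    then show ?thesis using composite_privateE[OF p _ \<rho>] composite by metis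
  qed
  have "(\<Sum>n\<in>F. (p / n) powr lam) \<le> (\<Sum>n\<in>F. (p powr - lam) ^ e * coprime_midpoint p (\<rho> n) powr - (2 * lam))"
    using composite_private_powr_le[OF p _ \<rho>] composite lam by (intro sum_mono) auto
  also have "\<dots> = (p powr - lam) ^ e * (\<Sum>r\<in>\<rho> ` F. coprime_midpoint p r powr - (2 * lam))"
    by (simp add: sum.reindex[OF inj] sum_distrib_left)
  also have "\<dots> \<le> (p powr - lam) ^ e * coprime_tail (2 * lam) p (real p ^ Suc e + 4 / (5 * (real p - 1)))"
    using F lam \<rho>_range prime_gt_1_nat[OF p]
    by (intro mult_left_mono sum_coprime_midpoint_powr_le) auto
  finally show ?thesis .
qed

lemma sum_power_le_geometric:
  fixes x :: real
  assumes "finite J" "\<And>j. j \<in> J \<Longrightarrow> m \<le> j" and x: "0 \<le> x" "x < 1"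
  shows "(\<Sum>j\<in>J. x ^ j) \<le> x ^ m / (1 - x)"
proof -
  define M where "M = Max (insert m J)"
  have M: "J \<subseteq> {m..M}" "m \<le> M" using assms by (auto simp: M_def)
  have "(\<Sum>j\<in>J. x ^ j) \<le> (\<Sum>j\<in>{m..M}. x ^ j)" using M x by (intro sum_mono2) auto
  also have "\<dots> = (x ^ m - x ^ Suc M) / (1 - x)" using M x by (subst sum_gp) auto
  also have "\<dots> \<le> x ^ m / (1 - x)" using x by (intro divide_right_mono) auto
  finally show ?thesis .
qed

lemma composite_private_sum_level_le_geometric:
  fixes lam :: real
  assumes p: "prime p" and lam: "lam > 1 / 2" and F: "finite F" "F \<subseteq> A"
    and composite: "\<And>n. n \<in> F \<Longrightarrow> multiplicity p n = Suc e \<and> (\<exists>r. composite_private A p n r)"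
  shows "(\<Sum>n\<in>F. (p / n) powr lam) \<le> coprime_tail (2 * lam) p p * (p powr (1 - 3 * lam)) ^ e"
proof -
  have p1: "real p > 1" using prime_gt_1_nat[OF p] by simp
  have "(\<Sum>n\<in>F. (p / n) powr lam)
      \<le> (p powr - lam) ^ e * coprime_tail (2 * lam) p (real p ^ Suc e + 4 / (5 * (real p - 1)))"
    using composite_private_sum_level_le[OF p lam F composite] .
  also have "\<dots> \<le> (p powr - lam) ^ e * coprime_tail (2 * lam) p (real p ^ Suc e)"
    unfolding coprime_tail_def using p1 lam by (intro mult_left_mono divide_right_mono powr_mono2') auto
  also have "\<dots> = coprime_tail (2 * lam) p p * (p powr - lam * p powr (1 - 2 * lam)) ^ e"
  proof -
    have "(real p ^ Suc e) powr (1 - 2 * lam) = p powr (1 - 2 * lam) * (p powr (1 - 2 * lam)) ^ e"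
      using p1 by (simp add: powr_powr powr_mult mult.commute flip: powr_realpow)
    then show ?thesis by (simp add: coprime_tail_def power_mult_distrib)
  qed
  also have "p powr - lam * p powr (1 - 2 * lam) = p powr (1 - 3 * lam)" by (simp flip: powr_add)
  finally show ?thesis .
qed

lemma composite_private_sum_le:
  fixes lam :: real
  assumes p: "prime p" and lam: "lam > 1 / 2" and F: "finite F" "F \<subseteq> A"
    and composite: "\<And>n. n \<in> F \<Longrightarrow> m < multiplicity p n \<and> (\<exists>r. composite_private A p n r)"
  shows "(\<Sum>n\<in>F. (p / n) powr lam)
    \<le> coprime_tail (2 * lam) p p * ((p powr (1 - 3 * lam)) ^ m / (1 - p powr (1 - 3 * lam)))"
proof -
  define x where "x = p powr (1 - 3 * lam)"
  define J where "J = (\<lambda>n. multiplicity p n - 1) ` F"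
  have p1: "real p > 1" using prime_gt_1_nat[OF p] by simp
  have "(\<Sum>n\<in>F. (p / n) powr lam) = (\<Sum>e\<in>J. \<Sum>n | n \<in> F \<and> multiplicity p n - 1 = e. (p / n) powr lam)"
    using F by (subst sum.group) (auto simp: J_def)
  also have "\<dots> \<le> (\<Sum>e\<in>J. coprime_tail (2 * lam) p p * x ^ e)"
    unfolding x_def using F composite
    by (intro sum_mono composite_private_sum_level_le_geometric[OF p lam, where A = A]) force+
  also have "\<dots> = coprime_tail (2 * lam) p p * (\<Sum>e\<in>J. x ^ e)" by (simp add: sum_distrib_left)
  also have "\<dots> \<le> coprime_tail (2 * lam) p p * (x ^ m / (1 - x))"
  proof (intro mult_left_mono sum_power_le_geometric)
    show "finite J" using F by (simp add: J_def)
    show "m \<le> j" if "j \<in> J" for j using that composite by (force simp: J_def)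
    show "0 \<le> x" "x < 1" using p1 lam by (simp_all add: x_def powr_less_one)
    show "0 \<le> coprime_tail (2 * lam) p p" using p1 lam by (simp add: coprime_tail_def)
  qed
  finally show ?thesis by (simp only: x_def)
qed

section \<open>Charges at one prime\<close>

text \<open>A fraction with a small denominator just below \<open>0.7983\<close>. The estimates for \<open>p = 2\<close> and
  \<open>p = 3\<close> leave little room for a smaller value.\<close>

definition lam0 :: real where "lam0 = 51 / 64"

lemma powr_neg_le_of_power_ge:
  fixes x c :: real
  assumes "x > 0" "c \<ge> 0" "b > 0" "1 \<le> c ^ b * x ^ a"
  shows "x powr - (real a / real b) \<le> c"
proof -
  have "(x powr - (real a / real b)) ^ b = x powr - real a"
    using assms by (simp add: powr_powr flip: powr_realpow)
  also have "\<dots> = 1 / x ^ a" using assms by (simp add: powr_minus powr_realpow divide_inverse)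
  also have "\<dots> \<le> c ^ b" using assms by (simp add: field_simps)
  finally show ?thesis using assms by (subst (asm) power_mono_iff) auto
qed

lemma powr_lam0_numeric:
  shows two_powr_lam0_le: "2 powr - lam0 \<le> 576 / 1000"
    and three_powr_lam0_le: "3 powr - lam0 \<le> 417 / 1000"
    and five_powr_lam0_le: "5 powr - lam0 \<le> 278 / 1000"
    and fourteen_fifths_powr_lam0_le: "(14 / 5) powr (1 - 2 * lam0) \<le> 543 / 1000"
  using powr_neg_le_of_power_ge[of 2 "576 / 1000" 64 51]
    powr_neg_le_of_power_ge[of 3 "417 / 1000" 64 51]
    powr_neg_le_of_power_ge[of 5 "278 / 1000" 64 51]
    powr_neg_le_of_power_ge[of "14 / 5" "543 / 1000" 32 19]
  by (simp_all add: lam0_def power_divide)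

lemma powr_one_minus_mult:
  fixes x a :: real
  assumes "x > 0"
  shows powr_one_minus_double: "x powr (1 - 2 * a) = x * (x powr - a)\<^sup>2"
    and powr_one_minus_triple: "x powr (1 - 3 * a) = x * (x powr - a) ^ 3"
proof -
  have "(x powr - a) ^ k = x powr (- (real k * a))" for k
    using assms by (simp add: powr_powr mult.commute flip: powr_realpow)
  from this[of 2] this[of 3] show "x powr (1 - 2 * a) = x * (x powr - a)\<^sup>2"
    and "x powr (1 - 3 * a) = x * (x powr - a) ^ 3"
    using assms powr_add[of x 1 "- (2 * a)"] powr_add[of x 1 "- (3 * a)"] by simp_all
qed

lemma geometric_coprime_tail_add_le_1:
  fixes p q u t :: real
  assumes q: "1 < q" "q \<le> p" and t: "1 - 1 / p \<le> t" and u: "q powr - lam0 \<le> u" "q * u ^ 3 < 1"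
    and le: "t * (q * u\<^sup>2) / (19 / 32) / (1 - q * u ^ 3) + 576 / 1000 * u \<le> 1"
  shows "coprime_tail (2 * lam0) p p / (1 - p powr (1 - 3 * lam0)) + (2 * p) powr - lam0 \<le> 1"
proof -
  have "p powr (1 - 2 * lam0) \<le> q powr (1 - 2 * lam0)"
    using q by (intro powr_mono2') (auto simp: lam0_def)
  also have "\<dots> \<le> q * u\<^sup>2" using powr_one_minus_double[of q lam0] q u(1) by (simp add: power_mono)
  finally have square: "p powr (1 - 2 * lam0) \<le> q * u\<^sup>2" .
  have "p powr (1 - 3 * lam0) \<le> q powr (1 - 3 * lam0)"
    using q by (intro powr_mono2') (auto simp: lam0_def)
  also have "\<dots> \<le> q * u ^ 3" using powr_one_minus_triple[of q lam0] q u(1) by (simp add: power_mono)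
  finally have cube: "p powr (1 - 3 * lam0) \<le> q * u ^ 3" .
  have "0 \<le> 1 - 1 / p" using q by simp
  then have "0 \<le> t" using t by (rule order_trans)
  then have "coprime_tail (2 * lam0) p p / (1 - p powr (1 - 3 * lam0))
      \<le> t * (q * u\<^sup>2) / (19 / 32) / (1 - q * u ^ 3)"
    unfolding coprime_tail_def using t square cube q u(2)
    by (intro frac_le mult_mono divide_nonneg_nonneg) (auto simp: lam0_def)
  moreover have "(2 * p) powr - lam0 \<le> 576 / 1000 * u"
  proof -
    have "p powr - lam0 \<le> q powr - lam0" using q by (intro powr_mono2') (auto simp: lam0_def)
    then show ?thesis
      unfolding powr_mult using two_powr_lam0_le u(1) by (intro mult_mono) auto
  qed
  ultimately show ?thesis using le by linarith
qed

lemma odd_composite_private_sum_le: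
  assumes p: "prime p" "p \<noteq> 2" and F: "finite F" "F \<subseteq> A"
    and composite: "\<And>n. n \<in> F \<Longrightarrow> 0 < multiplicity p n \<and> (\<exists>r. composite_private A p n r)"
  shows "(\<Sum>n\<in>F. (p / n) powr lam0) + (2 * p) powr - lam0 \<le> 1"
proof -
  have "p \<noteq> 4" using p(1) by auto
  then consider (three) "p = 3" | (large) "5 \<le> p" using p prime_ge_2_nat[of p] by linarith
  then have "coprime_tail (2 * lam0) p p / (1 - p powr (1 - 3 * lam0)) + (2 * real p) powr - lam0 \<le> 1"
  proof cases
    case three
    then show ?thesis
      by (intro geometric_coprime_tail_add_le_1[OF _ _ _ three_powr_lam0_le, where t = "2 / 3"])
        (auto simp: power2_eq_square power3_eq_cube)
  next
    case large
    then show ?thesis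
      by (intro geometric_coprime_tail_add_le_1[OF _ _ _ five_powr_lam0_le, where t = 1])
        (auto simp: power2_eq_square power3_eq_cube)
  qed
  moreover have "(\<Sum>n\<in>F. (p / n) powr lam0) \<le> coprime_tail (2 * lam0) p p / (1 - p powr (1 - 3 * lam0))"
    using composite_private_sum_le[OF p(1) _ F, of lam0 0] composite by (simp add: lam0_def)
  ultimately show ?thesis by simp
qed

text \<open>For \<open>p = 2\<close>, the geometric bound leaves no room for \<open>(2 * p) powr - lam0\<close>. Hence the first level
  is bounded separately, and the smaller summand \<open>8 powr - lam0\<close> is used if there are higher levels.\<close>

lemma even_composite_private_sum_first_level_le:
  assumes F: "finite F" "F \<subseteq> A"
    and composite: "\<And>n. n \<in> F \<Longrightarrow> multiplicity 2 n = 1 \<and> (\<exists>r. composite_private A 2 n r)"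
  shows "(\<Sum>n\<in>F. (2 / real n) powr lam0) \<le> 458 / 1000"
proof -
  have "(\<Sum>n\<in>F. (real 2 / real n) powr lam0)
    \<le> (real 2 powr - lam0) ^ 0 * coprime_tail (2 * lam0) (real 2) (real 2 ^ Suc 0 + 4 / (5 * (real 2 - 1)))"
    using F composite by (intro composite_private_sum_level_le[where A = A]) (auto simp: lam0_def)
  then have "(\<Sum>n\<in>F. (2 / real n) powr lam0) \<le> (14 / 5) powr (1 - 2 * lam0) / (2 * (2 * lam0 - 1))"
    by (simp add: coprime_tail_def)
  also have "\<dots> \<le> 543 / 1000 / (2 * (2 * lam0 - 1))"
    by (intro divide_right_mono fourteen_fifths_powr_lam0_le) (simp add: lam0_def)
  also have "\<dots> \<le> 458 / 1000" by (simp add: lam0_def)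
  finally show ?thesis .
qed

lemma even_composite_private_sum_higher_levels_le:
  assumes F: "finite F" "F \<subseteq> A"
    and composite: "\<And>n. n \<in> F \<Longrightarrow> 1 < multiplicity 2 n \<and> (\<exists>r. composite_private A 2 n r)"
  shows "(\<Sum>n\<in>F. (2 / real n) powr lam0) \<le> 346 / 1000"
proof -
  define u :: real where "u = 2 powr - lam0"
  have u: "0 \<le> u" "u \<le> 576 / 1000" unfolding u_def by (rule powr_ge_zero, rule two_powr_lam0_le)
  have "(\<Sum>n\<in>F. (real 2 / real n) powr lam0)
    \<le> coprime_tail (2 * lam0) (real 2) (real 2) * ((real 2 powr (1 - 3 * lam0)) ^ 1 / (1 - real 2 powr (1 - 3 * lam0)))"
    using F composite by (intro composite_private_sum_le[where A = A]) (auto simp: lam0_def)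
  also have "\<dots> = u\<^sup>2 / (19 / 32) * (2 * u ^ 3 / (1 - 2 * u ^ 3))"
    by (simp add: coprime_tail_def powr_one_minus_double powr_one_minus_triple u_def) (simp add: lam0_def)
  also have "\<dots> \<le> (576 / 1000)\<^sup>2 / (19 / 32) * (2 * (576 / 1000) ^ 3 / (1 - 2 * (576 / 1000) ^ 3))"
    using u power_mono[OF u(2,1), of 3]
    by (intro mult_mono frac_le power_mono) (auto simp: power2_eq_square power3_eq_cube)
  also have "\<dots> \<le> 346 / 1000" by (simp add: power2_eq_square power3_eq_cube)
  finally show ?thesis by simp
qed

lemma even_composite_private_sum_add_le_1:
  assumes F: "finite F" "F \<subseteq> A" "F \<noteq> {}"
    and composite: "\<And>n. n \<in> F \<Longrightarrow> 0 < multiplicity 2 n \<and> (\<exists>r. composite_private A 2 n r)"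
  shows "\<exists>n\<in>F. (\<Sum>n\<in>F. (2 / real n) powr lam0) + (2 * 2 ^ multiplicity 2 n) powr - lam0 \<le> 1"
proof (cases "\<forall>n\<in>F. multiplicity 2 n = 1")
  case True
  obtain n where n: "n \<in> F" using F(3) by blast
  have "(2 * 2 ^ multiplicity 2 n) powr - lam0 = (2 powr - lam0)\<^sup>2"
    using True n powr_mult[of 2 2 "- lam0"] by (simp add: power2_eq_square)
  also have "\<dots> \<le> (576 / 1000)\<^sup>2" using two_powr_lam0_le by (intro power_mono) auto
  finally have "(2 * 2 ^ multiplicity 2 n) powr - lam0 \<le> 332 / 1000" by (simp add: power2_eq_square)
  moreover have "(\<Sum>n\<in>F. (2 / real n) powr lam0) \<le> 458 / 1000"
    using F composite True by (intro even_composite_private_sum_first_level_le[where A = A]) auto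
  ultimately show ?thesis using n by (intro bexI[of _ n]) linarith+
next
  case False
  then obtain n where n: "n \<in> F" "multiplicity 2 n \<noteq> 1" by blast
  define E where "E = {n \<in> F. multiplicity 2 n = 1}"
  have "(2::real) ^ 3 \<le> 2 ^ Suc (multiplicity 2 n)"
    using composite[OF n(1)] n(2) by (intro power_increasing) auto
  then have "(2 * 2 ^ multiplicity 2 n) powr - lam0 \<le> (2 ^ 3) powr - lam0"
    by (intro powr_mono2') (auto simp: lam0_def)
  also have "\<dots> = (2 powr - lam0) ^ 3" by (simp only: power3_eq_cube powr_mult)
  also have "\<dots> \<le> (576 / 1000) ^ 3" using two_powr_lam0_le by (intro power_mono) auto
  finally have "(2 * 2 ^ multiplicity 2 n) powr - lam0 \<le> 192 / 1000" by (simp add: power3_eq_cube)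
  moreover have "(\<Sum>n\<in>F. (2 / real n) powr lam0)
      = (\<Sum>n\<in>F - E. (2 / real n) powr lam0) + (\<Sum>n\<in>E. (2 / real n) powr lam0)"
    using F(1) by (intro sum.subset_diff) (auto simp: E_def)
  moreover have "(\<Sum>n\<in>E. (2 / real n) powr lam0) \<le> 458 / 1000"
    using F composite by (intro even_composite_private_sum_first_level_le[where A = A]) (auto simp: E_def)
  moreover have "(\<Sum>n\<in>F - E. (2 / real n) powr lam0) \<le> 346 / 1000"
    using F composite
    by (intro even_composite_private_sum_higher_levels_le[where A = A]) (force simp: E_def)+
  ultimately show ?thesis using n(1) by (intro bexI[of _ n]) linarith+
qed

lemma composite_private_sum_add_le_1:
  assumes p: "prime p" and F: "finite F" "F \<subseteq> A" "F \<noteq> {}"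
    and composite: "\<And>n. n \<in> F \<Longrightarrow> 0 < multiplicity p n \<and> (\<exists>r. composite_private A p n r)"
  shows "\<exists>n\<in>F. (\<Sum>n\<in>F. (p / n) powr lam0) + (2 * real p ^ multiplicity p n) powr - lam0 \<le> 1"
proof (cases "p = 2")
  case True
  then show ?thesis using even_composite_private_sum_add_le_1[OF F] composite by simp
next
  case False
  obtain n where n: "n \<in> F" using F by blast
  have "real p ^ 1 \<le> real p ^ multiplicity p n"
    using composite[OF n] p prime_ge_1_nat by (intro power_increasing) auto
  then have "(2 * real p ^ multiplicity p n) powr - lam0 \<le> (2 * p) powr - lam0"
    using p prime_gt_0_nat by (intro powr_mono2') (auto simp: lam0_def)
  then show ?thesis using n odd_composite_private_sum_le[OF p False F(1,2) composite] by force
qed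

lemma primary_private_unique:
  assumes "n \<in> A" "m \<in> A" and n: "primary_private A p n" and m: "primary_private A p m"
  shows "n = m"
proof -
  have "p ^ multiplicity p n dvd m \<or> p ^ multiplicity p m dvd n"
    by (meson multiplicity_dvd' nle_le)
  then show ?thesis using assms by (auto simp: primary_private_def private_divisor_def)
qed

lemma primary_private_multiplicity_less:
  assumes n: "primary_private A p n" and b: "b \<in> A" "b \<noteq> n"
  shows "multiplicity p b < multiplicity p n"
proof (rule ccontr)
  assume "\<not> ?thesis"
  then have "p ^ multiplicity p n dvd b" by (intro multiplicity_dvd') simp
  then show False using assms by (auto simp: primary_private_def private_divisor_def)
qed

lemma primary_private_ge:
  assumes A: "two_primitive A" and p: "prime p" and n: "n \<in> A" "primary_private A p n"
    and bc: "b \<in> A" "c \<in> A" "b \<noteq> n" "c \<noteq> n" "b \<noteq> c" "p dvd c"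
  shows "2 * p ^ multiplicity p b * p \<le> n"
proof -
  obtain k where k: "n = p ^ multiplicity p n * k" using multiplicity_dvd by blast
  have pos: "n > 0" "c > 0" using A n bc by (auto simp: two_primitive_def)
  have p2: "p \<ge> 2" using p prime_ge_2_nat by blast
  have less: "multiplicity p b < multiplicity p n"
    using n(2) bc by (intro primary_private_multiplicity_less)
  have "k \<noteq> 0" using k pos(1) by (metis mult_0_right less_irrefl)
  then consider (exact) "k = 1" | (multiple) "k \<ge> 2" by linarith
  then show ?thesis
  proof cases
    case exact
    have "multiplicity p c \<ge> 1" using bc(6) p pos by (simp add: Suc_le_eq prime_multiplicity_gt_zero_iff)
    have "multiplicity p b + multiplicity p c < multiplicity p n"
    proof (rule ccontr)
      assume "\<not> ?thesis"
      then have "n dvd p ^ (multiplicity p b + multiplicity p c)"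
        using k exact by (metis le_imp_power_dvd mult.right_neutral not_less)
      also have "\<dots> dvd b * c" by (simp add: power_add mult_dvd_mono multiplicity_dvd)
      finally show False using A n(1) bc unfolding two_primitive_def by metis
    qed
    then have "multiplicity p b + 2 \<le> multiplicity p n" using \<open>multiplicity p c \<ge> 1\<close> by simp
    then have "p ^ (multiplicity p b + 2) \<le> p ^ multiplicity p n" using p2 by (intro power_increasing) auto
    moreover have "2 * p ^ multiplicity p b * p \<le> p ^ (multiplicity p b + 2)"
      using p2 by (simp add: power_add power2_eq_square)
    ultimately show ?thesis using k exact by (metis order_trans mult.right_neutral)
  next
    case multiple
    have "p ^ Suc (multiplicity p b) \<le> p ^ multiplicity p n" using less p2 by (intro power_increasing) auto
    then have "p ^ Suc (multiplicity p b) * 2 \<le> p ^ multiplicity p n * k" using multiple by (rule mult_le_mono)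
    then show ?thesis using k by (simp add: ac_simps)
  qed
qed

lemma ratio_powr_le:
  fixes q n m lam :: real
  assumes "q > 0" "m > 0" "m * q \<le> n" "lam \<ge> 0"
  shows "(q / n) powr lam \<le> m powr - lam"
proof -
  have "n > 0" using assms mult_pos_pos[of m q] by linarith
  then have "q / n \<le> 1 / m" using assms by (simp add: field_simps)
  then have "(q / n) powr lam \<le> (1 / m) powr lam"
    using assms \<open>n > 0\<close> by (intro powr_mono2) auto
  then show ?thesis using assms by (simp add: powr_divide powr_minus_divide)
qed

lemma composite_private_add_primary_le_1:
  fixes p b n :: nat
  assumes p: "prime p" and b: "0 < multiplicity p b" "composite_private A p b r"
    and n: "p\<^sup>2 dvd n" "n > 0"
  shows "(p / b) powr lam0 + (p / n) powr lam0 \<le> 1"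
proof -
  have p2: "p \<ge> 2" using p prime_ge_2_nat by blast
  obtain e where e: "multiplicity p b = Suc e" using b(1) by (cases "multiplicity p b") auto
  obtain c where c: "b = p ^ Suc e * r * c" "p ^ Suc e < r" "r < c"
    using composite_privateE[OF p e b(2)] by blast
  have pe: "p \<le> p ^ Suc e" using p2 by simp
  then have "3 \<le> r" "4 \<le> c" using c p2 by linarith+
  then have "p * 2 * 2 \<le> b" unfolding c(1) using pe by (intro mult_le_mono) auto
  then have "(p / b) powr lam0 \<le> 4 powr - lam0"
    using p2 by (intro ratio_powr_le) (auto simp: lam0_def)
  also have "\<dots> = (2 powr - lam0)\<^sup>2" using powr_mult[of 2 2 "- lam0"] by (simp add: power2_eq_square)
  also have "\<dots> \<le> (576 / 1000)\<^sup>2" using two_powr_lam0_le by (intro power_mono) auto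
  finally have "(p / b) powr lam0 \<le> (576 / 1000)\<^sup>2" .
  moreover have "2 * p \<le> p\<^sup>2" using p2 by (simp add: power2_eq_square)
  then have "2 * p \<le> n" using dvd_imp_le[OF n] by (rule order_trans)
  then have "(p / n) powr lam0 \<le> 2 powr - lam0"
    using p2 by (intro ratio_powr_le) (auto simp: lam0_def)
  ultimately show ?thesis using two_powr_lam0_le by (simp add: power2_eq_square)
qed

lemma composite_private_sum_add_primary_le_1:
  assumes A: "two_primitive A" and p: "prime p"
    and F: "finite F" "F \<subseteq> A" "n \<notin> F"
    and composite: "\<And>b. b \<in> F \<Longrightarrow> p dvd b \<and> (\<exists>r. composite_private A p b r)"
    and n: "n \<in> A" "p dvd n" "primary_private A p n"
  shows "(\<Sum>b\<in>F. (p / b) powr lam0) + (p / n) powr lam0 \<le> 1"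
proof -
  have p0: "p > 0" using p prime_gt_0_nat by blast
  have pos: "b > 0" if "b \<in> A" for b using that A by (auto simp: two_primitive_def)
  have mult_pos: "0 < multiplicity p b" if "b \<in> F" for b
    using that p composite pos F(2) by (auto simp: prime_multiplicity_gt_zero_iff)
  consider (empty) "F = {}" | (single) b where "F = {b}" | (several) "F \<noteq> {}" "\<And>b. F \<noteq> {b}" by blast
  then show ?thesis
  proof cases
    case empty
    have "p \<le> n" using n(2) pos[OF n(1)] by (rule dvd_imp_le)
    then have "(p / n) powr lam0 \<le> 1 powr - lam0"
      using p0 by (intro ratio_powr_le) (auto simp: lam0_def)
    then show ?thesis using empty by simp
  next
    case single
    have "multiplicity p b < multiplicity p n"
      using single F n(3) by (intro primary_private_multiplicity_less) auto
    then have "p\<^sup>2 dvd n" using mult_pos[of b] single by (intro multiplicity_dvd') simp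
    then show ?thesis
      using composite_private_add_primary_le_1[OF p] composite[of b] mult_pos[of b] single pos[OF n(1)]
      by auto
  next
    case several
    then obtain b where b: "b \<in> F" "(\<Sum>b\<in>F. (p / b) powr lam0) + (2 * real p ^ multiplicity p b) powr - lam0 \<le> 1"
      using composite_private_sum_add_le_1[OF p F(1,2)] composite mult_pos by blast
    then obtain c where c: "c \<in> F" "c \<noteq> b" using several(2)[of b] by blast
    have "2 * p ^ multiplicity p b * p \<le> n"
      using b(1) c F n(1,3) composite[of c] by (intro primary_private_ge[OF A p, of n b c]) auto
    then have "real (2 * p ^ multiplicity p b * p) \<le> n" by (simp only: of_nat_le_iff)
    then have "(p / n) powr lam0 \<le> (2 * real p ^ multiplicity p b) powr - lam0"
      using p0 by (intro ratio_powr_le) (auto simp: lam0_def)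
    then show ?thesis using b(2) by simp
  qed
qed

lemma private_sum_le_1:
  assumes A: "two_primitive A" and p: "prime p" and F: "finite F" "F \<subseteq> A"
    and charge: "\<And>n. n \<in> F \<Longrightarrow> p dvd n \<and> (primary_private A p n \<or> (\<exists>r. composite_private A p n r))"
  shows "(\<Sum>n\<in>F. (p / n) powr lam0) \<le> 1"
proof (cases "\<exists>n\<in>F. primary_private A p n")
  case True
  then obtain n where n: "n \<in> F" "primary_private A p n" by blast
  have "\<exists>r. composite_private A p b r" if "b \<in> F - {n}" for b
    using that charge primary_private_unique[of b A n p] n F(2) by auto
  then have "(\<Sum>b\<in>F - {n}. (p / b) powr lam0) + (p / n) powr lam0 \<le> 1"
    using F n charge by (intro composite_private_sum_add_primary_le_1[OF A p]) auto
  then show ?thesis using F(1) n(1) by (simp add: sum.remove)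
next
  case False
  show ?thesis
  proof (cases "F = {}")
    case nonempty: False
    have pos: "n > 0" if "n \<in> A" for n using that A by (auto simp: two_primitive_def)
    have "0 < multiplicity p n \<and> (\<exists>r. composite_private A p n r)" if "n \<in> F" for n
      using that charge False p F(2) pos[of n] by (auto simp: prime_multiplicity_gt_zero_iff)
    then obtain n where "(\<Sum>n\<in>F. (p / n) powr lam0) + (2 * real p ^ multiplicity p n) powr - lam0 \<le> 1"
      using composite_private_sum_add_le_1[OF p F nonempty] by blast
    then show ?thesis using powr_ge_zero[of "2 * real p ^ multiplicity p n" "- lam0"] by linarith
  qed simp
qed

section \<open>Comparison of the two sums\<close>

lemma sum_powr_le_sum_primes_dividing:
  fixes A :: "nat set" and \<phi> :: "nat \<Rightarrow> nat" and \<kappa> lam x :: real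
  assumes \<phi>: "\<And>n. n \<in> A \<Longrightarrow> 0 < n \<and> prime (\<phi> n) \<and> \<phi> n dvd n" and lam: "\<kappa> \<le> lam"
    and fibre: "\<And>q F. prime q \<Longrightarrow> finite F \<Longrightarrow> F \<subseteq> {n \<in> A. \<phi> n = q} \<Longrightarrow> (\<Sum>n\<in>F. (q / n) powr \<kappa>) \<le> 1"
  shows "(\<Sum>n | n \<in> A \<and> real n \<le> x. 1 / real n powr lam)
       \<le> (\<Sum>p | p \<in> primes_dividing A \<and> real p \<le> x. 1 / real p powr lam)"
proof -
  define N where "N = {n. n \<in> A \<and> real n \<le> x}"
  define P where "P = {p. p \<in> primes_dividing A \<and> real p \<le> x}"
  have finite: "finite N" "finite P"
    by (rule finite_subset[of _ "{..nat \<lfloor>x\<rfloor>}"]; force simp: N_def P_def le_nat_floor)+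
  have \<phi>_le: "0 < \<phi> n" "\<phi> n \<le> n" if "n \<in> A" for n
    using \<phi>[OF that] by (auto simp: prime_gt_0_nat intro: dvd_imp_le)
  have "\<phi> ` N \<subseteq> P"
  proof (rule image_subsetI)
    fix n assume "n \<in> N"
    then have n: "n \<in> A" "real n \<le> x" by (auto simp: N_def)
    then have "real (\<phi> n) \<le> x" using \<phi>_le(2)[OF n(1)] by linarith
    then show "\<phi> n \<in> P" using \<phi>[OF n(1)] n(1) by (auto simp: P_def primes_dividing_def)
  qed
  then have "(\<Sum>n\<in>N. 1 / real n powr lam) = (\<Sum>q\<in>P. \<Sum>n | n \<in> N \<and> \<phi> n = q. 1 / real n powr lam)"
    by (rule sum.group[OF finite, symmetric])
  also have "\<dots> \<le> (\<Sum>q\<in>P. 1 / real q powr lam * (\<Sum>n | n \<in> N \<and> \<phi> n = q. (q / n) powr \<kappa>))"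
    unfolding sum_distrib_left
  proof (intro sum_mono)
    fix q n assume "n \<in> {n. n \<in> N \<and> \<phi> n = q}"
    then have qn: "0 < q" "q \<le> n" using \<phi>_le by (auto simp: N_def)
    then have "1 / real n powr lam = 1 / real q powr lam * (q / n) powr lam"
      by (simp add: powr_divide)
    also have "\<dots> \<le> 1 / real q powr lam * (q / n) powr \<kappa>"
      using lam qn by (intro mult_left_mono powr_mono') auto
    finally show "1 / real n powr lam \<le> 1 / real q powr lam * (q / n) powr \<kappa>" .
  qed
  also have "\<dots> \<le> (\<Sum>q\<in>P. 1 / real q powr lam)"
  proof (rule sum_mono)
    fix q assume "q \<in> P"
    then have "prime q" by (simp add: P_def primes_dividing_def)
    moreover have "finite {n. n \<in> N \<and> \<phi> n = q}" using finite(1) by simp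
    ultimately have "(\<Sum>n | n \<in> N \<and> \<phi> n = q. (q / n) powr \<kappa>) \<le> 1"
      by (rule fibre) (auto simp: N_def)
    then show "1 / real q powr lam * (\<Sum>n | n \<in> N \<and> \<phi> n = q. (q / n) powr \<kappa>) \<le> 1 / real q powr lam"
      by (simp add: divide_right_mono)
  qed
  finally show ?thesis by (simp only: N_def P_def)
qed

theorem theorem1p5:
  fixes lam x :: real and A :: "nat set"
  assumes "lam \<ge> 0.7983" and "x \<ge> 2" and "two_primitive A"
  shows "(\<Sum>n | n \<in> A \<and> real n \<le> x. 1 / real n powr lam)
       \<le> (\<Sum>p | p \<in> primes_dividing A \<and> real p \<le> x. 1 / real p powr lam)"
proof -
  have pos: "0 < n" if "n \<in> A" for n using that assms(3) by (auto simp: two_primitive_def)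
  obtain \<phi> where \<phi>: "\<And>n. n \<in> A \<Longrightarrow> prime (\<phi> n) \<and> \<phi> n dvd n \<and>
      (primary_private A (\<phi> n) n \<or> (\<exists>r. composite_private A (\<phi> n) n r))"
    using exists_primary_or_composite_private[OF assms(3)] by metis
  show ?thesis
  proof (rule sum_powr_le_sum_primes_dividing)
    show "0 < n \<and> prime (\<phi> n) \<and> \<phi> n dvd n" if "n \<in> A" for n using pos[OF that] \<phi>[OF that] by blast
    show "lam0 \<le> lam" using assms(1) by (simp add: lam0_def)
    show "(\<Sum>n\<in>F. (q / n) powr lam0) \<le> 1"
      if "prime q" "finite F" "F \<subseteq> {n \<in> A. \<phi> n = q}" for q F
      using that \<phi> by (intro private_sum_le_1[OF assms(3)]) auto
  qed
qed

end
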